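(* Let $S$ be an object in the category $\mathbf{Cu}$. The following conditions are equivalent. (i) $S$ has property (CFP4S). (ii) For every sequence $(y_i)_{i=1}^\infty$ in $S$, if there is a full sequence $(x_i)_{i=1}^\infty$ in $S$ such that $my_i\ge x_i$ for some $m$ and for all $i$, then $\sum_{i=1}^\infty y_i=\infty$. (iii) For every sequence $(y_i)_{i=1}^\infty$ in $S$, if $my_i=\infty$ for some $m$ and for all $i$, then $\sum_{i=1}^\infty y_i=\infty$. (iv) For every sequence $(y_i)_{i=1}^\infty$ in $S$, if $\sum_{i=n}^\infty my_i=\infty$ for some $m$ and for all $n$, then $\sum_{i=1}^\infty y_i=\infty$. (v) For every full element $y$ in $S$, if $y$ is $(\omega,m)$-decomposable for some $m$, then $y$ is properly infinite (whence $y=\infty$).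
   Context: An object of $\mathbf{Cu}$ is an ordered abelian semigroup $S$ (with neutral element $0$ which is the least element, and with addition compatible with the order) such that: (A1) every increasing sequence in $S$ has a supremum; (A2) for every $u\in S$ there is a sequence $(u_i)$ with $u_i\ll u_{i+1}$ and $\sup_iu_i=u$; (A3) if $u'\ll u$ and $v'\ll v$ then $u'+v'\ll u+v$; (A4) if $(u_i),(v_i)$ are increasing then $\sup_iu_i+\sup_iv_i=\sup_i(u_i+v_i)$. Here $u\ll v$ means that whenever $(v_i)$ is an increasing sequence with $v\le\sup_iv_i$, then $u\le v_i$ for some $i$. Infinite sums are suprema of partial sums, and $\infty\cdot x=\sup_k kx$. Writing $z=\infty$ means that $z$ is the largest element of $S$. An element $x\in S$ is full if $\infty\cdot x=\infty$. A sequence $(x_i)_{i=1}^\infty$ is full if it is increasing and $\sup_ix_i$ is full. An element $u$ is properly infinite if $u=2u$. For an integer $n\ge1$, $u\in S$ is $(\omega,n)$-decomposable if there exist $x_1,x_2,\dots\in S$ with $\sum_{i=1}^\infty x_i\le u$ and $u\le nx_i$ for all $i$. In (ii)–(v), $m$ denotes a positive integer. $S$ has property (CFP4S) if whenever $(x_i)_{i=1}^\infty$ is a full sequence, $x'\ll x_1$, and $(y_i)_{i=1}^\infty$ is such that $my_i\ge x_i$ for all $i$ and some positive integer $m$, then there exists $n$ such that $\sum_{i=1}^ny_i\ge x'$. *)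

theory Defs
  imports Complex_Main
begin

context order
begin

text \<open>The library's \<open>incseq f\<close> is, literally, \<open>monotone (\<le>) (\<le>) f\<close>; the latter form is used
  where it has to make sense before the type class \<open>cu\<close> is available.\<close>

definition is_seq_sup :: "(nat \<Rightarrow> 'a) \<Rightarrow> 'a \<Rightarrow> bool"
  where "is_seq_sup f s \<longleftrightarrow> (\<forall>i. f i \<le> s) \<and> (\<forall>t. (\<forall>i. f i \<le> t) \<longrightarrow> s \<le> t)"

text \<open>\<open>seq_sup f\<close> is unspecified when \<open>f\<close> has no supremum; in an object of Cu this cannot happen
  for increasing \<open>f\<close> (lemma \<open>is_seq_sup_seq_sup\<close>), and it is applied only to such sequences.\<close>

definition seq_sup :: "(nat \<Rightarrow> 'a) \<Rightarrow> 'a"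
  where "seq_sup f = (THE s. is_seq_sup f s)"

definition way_below :: "'a \<Rightarrow> 'a \<Rightarrow> bool" (infix "\<lless>" 50)
  where "u \<lless> v \<longleftrightarrow>
    (\<forall>w s. monotone (\<le>) (\<le>) w \<longrightarrow> is_seq_sup w s \<longrightarrow> v \<le> s \<longrightarrow> (\<exists>i. u \<le> w i))"

lemma seq_sup_eqI: "is_seq_sup f s \<Longrightarrow> seq_sup f = s"
  unfolding seq_sup_def by (rule the_equality) (auto simp: is_seq_sup_def intro: order.antisym)

end

class cu = ordered_comm_monoid_add +
  assumes zero_least: "0 \<le> x"
    and A1: "monotone (\<le>) (\<le>) f \<Longrightarrow> \<exists>s. is_seq_sup f s"
    and A2: "\<exists>f. (\<forall>i. f i \<lless> f (Suc i)) \<and> is_seq_sup f u"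
    and A3: "u' \<lless> u \<Longrightarrow> v' \<lless> v \<Longrightarrow> u' + v' \<lless> u + v"
    and A4: "monotone (\<le>) (\<le>) f \<Longrightarrow> monotone (\<le>) (\<le>) g \<Longrightarrow>
      seq_sup f + seq_sup g = seq_sup (\<lambda>i. f i + g i)"

lemma is_seq_sup_seq_sup:
  fixes f :: "nat \<Rightarrow> 'a::cu"
  shows "incseq f \<Longrightarrow> is_seq_sup f (seq_sup f)"
  by (auto dest!: A1 simp: seq_sup_eqI)

definition nmult :: "nat \<Rightarrow> 'a::comm_monoid_add \<Rightarrow> 'a" (infixr "\<odot>" 75)
  where "k \<odot> x = (\<Sum>i<k. x)"

definition inf_sum :: "(nat \<Rightarrow> 'a::cu) \<Rightarrow> 'a"
  where "inf_sum x = seq_sup (\<lambda>n. \<Sum>i<n. x i)"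

definition inf_mult :: "'a::cu \<Rightarrow> 'a"
  where "inf_mult x = seq_sup (\<lambda>k. k \<odot> x)"

text \<open>A Cu-semigroup need not have a largest element, so ``\<open>z = \<infinity>\<close>'' is a predicate on \<open>z\<close>.\<close>

definition is_infinity :: "'a::cu \<Rightarrow> bool"
  where "is_infinity z \<longleftrightarrow> (\<forall>x. x \<le> z)"

definition full :: "'a::cu \<Rightarrow> bool"
  where "full x \<longleftrightarrow> is_infinity (inf_mult x)"

definition full_seq :: "(nat \<Rightarrow> 'a::cu) \<Rightarrow> bool"
  where "full_seq x \<longleftrightarrow> incseq x \<and> full (seq_sup x)"

definition properly_infinite :: "'a::cu \<Rightarrow> bool"
  where "properly_infinite u \<longleftrightarrow> u = 2 \<odot> u"

definition omega_decomposable :: "nat \<Rightarrow> 'a::cu \<Rightarrow> bool"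
  where "omega_decomposable n u \<longleftrightarrow>
    (\<exists>x. inf_sum x \<le> u \<and> (\<forall>i. u \<le> n \<odot> x i))"

text \<open>Sequences are indexed from 0, so \<open>x 0\<close> is the first term and \<open>{..n}\<close> ranges over the
  nonempty initial segments. The type argument stands for the semigroup.\<close>

definition CFP4S :: "'a::cu itself \<Rightarrow> bool"
  where "CFP4S _ \<longleftrightarrow>
    (\<forall>(x :: nat \<Rightarrow> 'a) x' y.
      full_seq x \<longrightarrow> x' \<lless> x 0 \<longrightarrow> (\<exists>m>0. \<forall>i. x i \<le> m \<odot> y i) \<longrightarrow>
      (\<exists>n. x' \<le> (\<Sum>i\<le>n. y i)))"

end

(* A sequence y can be cut into infinitely many disjoint infinite rows, and the row sums z j satisfy
   inf_sum z \<le> inf_sum y. This upgrades estimates in two places: if m copies of y dominate a full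
   sequence x, then m \<odot> z j dominates the sum of all x i, which is infinity, giving (iii) \<Longrightarrow> (ii); and
   CFP4S, applied to the tails of each row, gives sup x \<le> z j, hence infinity = inf_mult (sup x) \<le> inf_sum y,
   giving (i) \<Longrightarrow> (ii). For (ii) \<Longrightarrow> (iv), write infinity as the supremum of a rapidly increasing
   sequence x and cut y into consecutive finite blocks, the j-th block dominating x j after
   multiplication by m. *)

theory Submission
  imports Defs "HOL-Library.Nat_Bijection"
begin

section \<open>Suprema of increasing sequences and the way-below relation\<close>

lemma seq_sup_upper: "incseq f \<Longrightarrow> f i \<le> seq_sup f" for f :: "nat \<Rightarrow> 'a::cu"
  using is_seq_sup_seq_sup[of f] by (auto simp: is_seq_sup_def)

lemma seq_sup_least: "incseq f \<Longrightarrow> (\<And>i. f i \<le> t) \<Longrightarrow> seq_sup f \<le> t" for f :: "nat \<Rightarrow> 'a::cu"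
  using is_seq_sup_seq_sup[of f] by (auto simp: is_seq_sup_def)

lemma seq_sup_const [simp]: "seq_sup (\<lambda>_. a) = a" for a :: "'a::cu"
  by (rule seq_sup_eqI) (auto simp: is_seq_sup_def)

lemma way_below_incseqD:
  fixes u :: "'a::cu"
  assumes "u \<lless> v" "incseq w" "v \<le> seq_sup w"
  shows "\<exists>i. u \<le> w i"
  using assms is_seq_sup_seq_sup[of w] unfolding way_below_def by blast

lemma way_below_imp_le: "u \<lless> v \<Longrightarrow> u \<le> v" for u :: "'a::cu"
  using way_below_incseqD[of u v "\<lambda>_. v"] by (simp add: incseq_def)

lemma way_below_le_trans: "u \<lless> v \<Longrightarrow> v \<le> w \<Longrightarrow> u \<lless> w" for u :: "'a::cu"
  unfolding way_below_def by (meson order_trans)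

lemma rapidly_increasing_seq:
  fixes u :: "'a::cu"
  obtains f where "incseq f" "seq_sup f = u" "\<And>i. f i \<lless> u"
proof -
  obtain f where f: "\<And>i. f i \<lless> f (Suc i)" "is_seq_sup f u"
    using A2[of u] by blast
  have "f i \<lless> u" for i
    using f way_below_le_trans[of "f i" "f (Suc i)" u] by (simp add: is_seq_sup_def)
  moreover have "incseq f"
    by (rule incseq_SucI) (rule way_below_imp_le[OF f(1)])
  ultimately show ?thesis
    using f(2) by (intro that[of f]) (auto intro: seq_sup_eqI)
qed

text \<open>By (A2), \<open>u\<close> is the supremum of elements way below it, so an upper bound
  for those bounds \<open>u\<close>.\<close>

lemma le_if_way_below_le:
  fixes u :: "'a::cu"
  assumes "\<And>w. w \<lless> u \<Longrightarrow> w \<le> t"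
  shows "u \<le> t"
  using rapidly_increasing_seq[of u] assms by (metis seq_sup_least)

section \<open>Finite and infinite sums\<close>

lemma sum_mono2_cu:
  fixes f :: "'i \<Rightarrow> 'a::cu"
  assumes "finite B" "A \<subseteq> B"
  shows "sum f A \<le> sum f B"
proof -
  have "sum f A + 0 \<le> sum f A + sum f (B - A)"
    by (intro add_left_mono zero_least)
  also have "\<dots> = sum f B"
    using assms by (metis add.commute sum.subset_diff)
  finally show ?thesis by simp
qed

lemma incseq_sum_lessThan: "incseq (\<lambda>n. \<Sum>i<n. f i)" for f :: "nat \<Rightarrow> 'a::cu"
  by (auto simp: incseq_def intro!: sum_mono2_cu)

lemma incseq_sum:
  fixes f :: "'j \<Rightarrow> nat \<Rightarrow> 'a::cu"
  assumes "\<And>j. j \<in> J \<Longrightarrow> incseq (f j)"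
  shows "incseq (\<lambda>i. \<Sum>j\<in>J. f j i)"
  using assms by (auto simp: incseq_def intro!: sum_mono)

text \<open>This is (A4) extended from two summands to finitely many. With constant summands it lets
  multiples commute with suprema and infinite sums.\<close>

lemma sum_seq_sup:
  fixes f :: "'j \<Rightarrow> nat \<Rightarrow> 'a::cu"
  assumes "\<And>j. j \<in> J \<Longrightarrow> incseq (f j)"
  shows "(\<Sum>j\<in>J. seq_sup (f j)) = seq_sup (\<lambda>i. \<Sum>j\<in>J. f j i)"
  using assms
proof (induction J rule: infinite_finite_induct)
  case (insert a J)
  then show ?case
    using A4[of "f a" "\<lambda>i. \<Sum>j\<in>J. f j i"] incseq_sum[of J f] by simp
qed simp_all

lemma nmult_sum: "k \<odot> (\<Sum>i\<in>A. f i) = (\<Sum>i\<in>A. k \<odot> f i)"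
  unfolding nmult_def by (rule sum.swap)

lemma partial_sum_le_inf_sum: "(\<Sum>i<n. f i) \<le> inf_sum f" for f :: "nat \<Rightarrow> 'a::cu"
  unfolding inf_sum_def by (rule seq_sup_upper[OF incseq_sum_lessThan])

lemma inf_sum_least: "(\<And>n. (\<Sum>i<n. f i) \<le> t) \<Longrightarrow> inf_sum f \<le> t" for f :: "nat \<Rightarrow> 'a::cu"
  unfolding inf_sum_def by (rule seq_sup_least[OF incseq_sum_lessThan])

lemma finite_sum_le_inf_sum:
  fixes f :: "nat \<Rightarrow> 'a::cu"
  assumes "finite A"
  shows "sum f A \<le> inf_sum f"
proof -
  obtain n where "A \<subseteq> {..<n}"
    using assms by (auto simp: finite_nat_set_iff_bounded)
  then have "sum f A \<le> (\<Sum>i<n. f i)"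
    by (intro sum_mono2_cu) auto
  then show ?thesis
    using partial_sum_le_inf_sum order_trans by blast
qed

lemma inf_sum_mono: "(\<And>i. f i \<le> g i) \<Longrightarrow> inf_sum f \<le> inf_sum g" for f :: "nat \<Rightarrow> 'a::cu"
  by (intro inf_sum_least order_trans[OF sum_mono partial_sum_le_inf_sum])

lemma sum_inf_sum:
  fixes f :: "'j \<Rightarrow> nat \<Rightarrow> 'a::cu"
  shows "(\<Sum>j\<in>J. inf_sum (f j)) = inf_sum (\<lambda>i. \<Sum>j\<in>J. f j i)"
  unfolding inf_sum_def by (subst sum_seq_sup) (auto simp: incseq_sum_lessThan sum.swap[of _ J])

lemma nmult_inf_sum: "k \<odot> inf_sum f = inf_sum (\<lambda>i. k \<odot> f i)" for f :: "nat \<Rightarrow> 'a::cu"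
  unfolding nmult_def by (rule sum_inf_sum)

text \<open>Reading an infinite multiple as an infinite sum makes the bounds for
  \<open>inf_sum\<close> available for \<open>inf_mult\<close>.\<close>

lemma inf_mult_eq_inf_sum: "inf_mult a = inf_sum (\<lambda>_. a)" for a :: "'a::cu"
  by (simp add: inf_mult_def inf_sum_def nmult_def)

text \<open>By (A4) the sum of the first \<open>J\<close> rows is a supremum of sums over finite
  rectangles. As \<open>prod_encode\<close> is injective, each of these is a sum of \<open>y\<close>
  over a finite set of indices.\<close>

lemma inf_sum_rows_le:
  fixes y :: "nat \<Rightarrow> 'a::cu"
  shows "inf_sum (\<lambda>j. inf_sum (\<lambda>i. y (prod_encode (j, i)))) \<le> inf_sum y"
proof (rule inf_sum_least)
  fix J
  have "(\<Sum>i<n. \<Sum>j<J. y (prod_encode (j, i))) \<le> inf_sum y" for n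
  proof -
    have "(\<Sum>i<n. \<Sum>j<J. y (prod_encode (j, i))) = (\<Sum>p\<in>{..<J} \<times> {..<n}. y (prod_encode p))"
      by (subst sum.swap) (simp add: sum.cartesian_product)
    also have "\<dots> = sum y (prod_encode ` ({..<J} \<times> {..<n}))"
      by (simp add: sum.reindex[OF inj_prod_encode])
    also have "\<dots> \<le> inf_sum y"
      by (intro finite_sum_le_inf_sum) simp
    finally show ?thesis .
  qed
  then show "(\<Sum>j<J. inf_sum (\<lambda>i. y (prod_encode (j, i)))) \<le> inf_sum y"
    by (simp add: sum_inf_sum inf_sum_least)
qed

text \<open>Since \<open>x\<close> increases, \<open>k\<close> copies of \<open>x i\<close> lie
  below the sum of the \<open>k\<close> consecutive terms starting at \<open>x i\<close>. Taking the
  supremum over \<open>i\<close> replaces \<open>x i\<close> by \<open>seq_sup x\<close>.\<close>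

lemma inf_mult_seq_sup_le_inf_sum:
  fixes x :: "nat \<Rightarrow> 'a::cu"
  assumes "incseq x"
  shows "inf_mult (seq_sup x) \<le> inf_sum x"
  unfolding inf_mult_eq_inf_sum
proof (rule inf_sum_least)
  fix k :: nat
  have "(\<Sum>l<k. x i) \<le> inf_sum x" for i
  proof -
    have "(\<Sum>l<k. x i) \<le> (\<Sum>l<k. x (i + l))"
      using assms by (intro sum_mono) (simp add: incseq_def)
    also have "\<dots> = sum x ((+) i ` {..<k})"
      by (simp add: sum.reindex)
    also have "\<dots> \<le> inf_sum x"
      by (intro finite_sum_le_inf_sum) simp
    finally show ?thesis .
  qed
  then show "(\<Sum>l<k. seq_sup x) \<le> inf_sum x"
    using assms by (simp add: sum_seq_sup seq_sup_least incseq_sum)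
qed

lemma inf_sum_shift_le: "inf_sum (\<lambda>i. y (N + i)) \<le> inf_sum y" for y :: "nat \<Rightarrow> 'a::cu"
proof (rule inf_sum_least)
  fix n
  have "(\<Sum>i<n. y (N + i)) = sum y ((+) N ` {..<n})"
    by (simp add: sum.reindex)
  also have "\<dots> \<le> inf_sum y"
    by (intro finite_sum_le_inf_sum) simp
  finally show "(\<Sum>i<n. y (N + i)) \<le> inf_sum y" .
qed

section \<open>Infinity, fullness and proper infiniteness\<close>

lemma is_infinity_mono: "is_infinity a \<Longrightarrow> a \<le> b \<Longrightarrow> is_infinity b"
  unfolding is_infinity_def by (meson order_trans)

lemma nmult_le_inf_mult: "k \<odot> a \<le> inf_mult a" for a :: "'a::cu"
  unfolding inf_mult_eq_inf_sum nmult_def by (rule partial_sum_le_inf_sum)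

lemma full_if_nmult_infinity: "is_infinity (k \<odot> a) \<Longrightarrow> full a"
  unfolding full_def by (rule is_infinity_mono[OF _ nmult_le_inf_mult])

lemma full_mono: "full a \<Longrightarrow> a \<le> b \<Longrightarrow> full b"
  unfolding full_def inf_mult_eq_inf_sum by (auto elim: is_infinity_mono intro: inf_sum_mono)

lemma full_if_infinity: "is_infinity a \<Longrightarrow> full a"
  using full_if_nmult_infinity[of 1 a] by (simp add: nmult_def)

lemma full_seq_const: "full_seq (\<lambda>_. a) \<longleftrightarrow> full a"
  by (simp add: full_seq_def incseq_def)

lemma full_seq_shift:
  assumes "full_seq x"
  shows "full_seq (\<lambda>i. x (N + i))"
proof -
  have inc: "incseq x" and inc': "incseq (\<lambda>i. x (N + i))"
    using assms by (auto simp: full_seq_def incseq_def)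
  have "x i \<le> seq_sup (\<lambda>i. x (N + i))" for i
    using order_trans[OF incseqD[OF inc le_add2[of i N]] seq_sup_upper[OF inc', of i]] .
  then have "seq_sup x \<le> seq_sup (\<lambda>i. x (N + i))"
    by (rule seq_sup_least[OF inc])
  then show ?thesis
    using assms inc' by (auto simp: full_seq_def intro: full_mono)
qed

lemma properly_infinite_full_imp_infinity:
  assumes "full u" "properly_infinite u"
  shows "is_infinity u"
proof -
  have double: "u + u = u"
    using assms(2) by (simp add: properly_infinite_def nmult_def numeral_2_eq_2)
  have "(\<Sum>i<k. u) \<le> u" for k :: nat
  proof (induction k)
    case (Suc k)
    then show ?case
      using add_right_mono[of "\<Sum>i<k. u" u u] double by (simp add: add.commute)
  qed (simp add: zero_least)
  then have "inf_mult u \<le> u"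
    unfolding inf_mult_eq_inf_sum by (rule inf_sum_least)
  then show ?thesis
    using assms(1) by (auto simp: full_def elim: is_infinity_mono)
qed

lemma infinity_imp_properly_infinite:
  assumes "is_infinity u"
  shows "properly_infinite u"
proof -
  have "u \<le> 2 \<odot> u"
    using add_left_mono[OF zero_least[of u], of u] by (simp add: nmult_def numeral_2_eq_2)
  moreover have "2 \<odot> u \<le> u"
    using assms by (simp add: is_infinity_def)
  ultimately show ?thesis
    by (simp add: properly_infinite_def order.antisym)
qed

section \<open>Property (CFP4S), row sums and block sums\<close>

lemma CFP4S_seq_sup_le_inf_sum:
  fixes x :: "nat \<Rightarrow> 'a::cu"
  assumes "CFP4S TYPE('a)" "full_seq x" "m > 0" "\<And>i. x i \<le> m \<odot> y i"
  shows "seq_sup x \<le> inf_sum y"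
proof (rule seq_sup_least)
  show "incseq x"
    using assms(2) by (simp add: full_seq_def)
  fix N
  show "x N \<le> inf_sum y"
  proof (rule le_if_way_below_le)
    fix w assume "w \<lless> x N"
    \<comment> \<open>(CFP4S) controls only elements way below the first term, so it is applied to
      the tails of \<open>x\<close> and \<open>y\<close> starting at \<open>N\<close>.\<close>
    then obtain n where "w \<le> (\<Sum>i\<le>n. y (N + i))"
      using assms(1)[unfolded CFP4S_def, rule_format, of "\<lambda>i. x (N + i)" w "\<lambda>i. y (N + i)"]
        assms(3,4) full_seq_shift[OF assms(2), of N] by auto
    also have "\<dots> \<le> inf_sum (\<lambda>i. y (N + i))"
      by (intro finite_sum_le_inf_sum) simp
    also have "\<dots> \<le> inf_sum y"
      by (rule inf_sum_shift_le)
    finally show "w \<le> inf_sum y" .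
  qed
qed

text \<open>Since \<open>i \<le> prod_encode (j, i)\<close> and \<open>x\<close> increases, passing
  to a row keeps the domination by the same \<open>x\<close>.\<close>

lemma dominated_seq_prod_encode:
  fixes x :: "nat \<Rightarrow> 'a::cu"
  assumes "incseq x" "\<And>i. x i \<le> m \<odot> y i"
  shows "x i \<le> m \<odot> y (prod_encode (j, i))"
  using incseqD[OF assms(1) le_prod_encode_2] assms(2) order_trans by blast

lemma CFP4S_imp_infinity:
  fixes x :: "nat \<Rightarrow> 'a::cu"
  assumes "CFP4S TYPE('a)" "full_seq x" "m > 0" "\<And>i. x i \<le> m \<odot> y i"
  shows "is_infinity (inf_sum y)"
proof -
  have "seq_sup x \<le> inf_sum (\<lambda>i. y (prod_encode (j, i)))" for j
    using assms dominated_seq_prod_encode[of x m y]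
    by (intro CFP4S_seq_sup_le_inf_sum[where m = m]) (auto simp: full_seq_def)
  then have "inf_mult (seq_sup x) \<le> inf_sum (\<lambda>j. inf_sum (\<lambda>i. y (prod_encode (j, i))))"
    unfolding inf_mult_eq_inf_sum by (rule inf_sum_mono)
  also have "\<dots> \<le> inf_sum y"
    by (rule inf_sum_rows_le)
  finally show ?thesis
    using assms(2) by (auto simp: full_seq_def full_def elim: is_infinity_mono)
qed

text \<open>An infinite \<open>inf_sum y\<close> lies above \<open>x 0\<close>; as \<open>x'\<close>
  is way below \<open>x 0\<close>, some partial sum already lies above \<open>x'\<close>.\<close>

lemma CFP4S_if_infinity:
  assumes "\<And>(x :: nat \<Rightarrow> 'a::cu) y m. full_seq x \<Longrightarrow> m > 0 \<Longrightarrow> (\<And>i. x i \<le> m \<odot> y i) \<Longrightarrow>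
    is_infinity (inf_sum y)"
  shows "CFP4S TYPE('a)"
  unfolding CFP4S_def
proof (intro allI impI)
  fix x y :: "nat \<Rightarrow> 'a" and x'
  assume x: "full_seq x" "x' \<lless> x 0" and "\<exists>m>0. \<forall>i. x i \<le> m \<odot> y i"
  then have "x 0 \<le> inf_sum y"
    using assms by (metis is_infinity_def)
  then obtain n where "x' \<le> (\<Sum>i<n. y i)"
    using way_below_incseqD[OF x(2) incseq_sum_lessThan[of y]] by (auto simp: inf_sum_def)
  \<comment> \<open>One extra term turns a possibly empty partial sum into the nonempty one that
    \<open>CFP4S\<close> asks for.\<close>
  also have "\<dots> \<le> (\<Sum>i\<le>n. y i)"
    by (intro sum_mono2_cu) auto
  finally show "\<exists>n. x' \<le> (\<Sum>i\<le>n. y i)" by blast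
qed

lemma row_sum_infinity:
  fixes x :: "nat \<Rightarrow> 'a::cu"
  assumes "full_seq x" "\<And>i. x i \<le> m \<odot> y i"
  shows "is_infinity (m \<odot> inf_sum (\<lambda>i. y (prod_encode (j, i))))"
proof -
  have inc: "incseq x"
    using assms(1) by (simp add: full_seq_def)
  have "inf_mult (seq_sup x) \<le> inf_sum x"
    by (rule inf_mult_seq_sup_le_inf_sum[OF inc])
  also have "\<dots> \<le> inf_sum (\<lambda>i. m \<odot> y (prod_encode (j, i)))"
    by (intro inf_sum_mono dominated_seq_prod_encode[OF inc assms(2)])
  finally show ?thesis
    using assms(1) by (auto simp: full_seq_def full_def nmult_inf_sum elim: is_infinity_mono)
qed

text \<open>This turns the hypothesis of (iv) into that of (ii), with block sums \<open>z\<close> in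
  place of \<open>y\<close>.\<close>

lemma full_seq_blocks:
  fixes y :: "nat \<Rightarrow> 'a::cu"
  assumes "\<And>n. is_infinity (inf_sum (\<lambda>i. m \<odot> y (n + i)))"
  obtains x z where "full_seq x" "\<And>j. x j \<le> m \<odot> z j" "inf_sum z \<le> inf_sum y"
proof -
  define u where "u = inf_sum (\<lambda>i. m \<odot> y (0 + i))"
  have u: "is_infinity u"
    unfolding u_def by (rule assms)
  obtain x where x: "incseq x" "seq_sup x = u" "\<And>i. x i \<lless> u"
    using rapidly_increasing_seq[of u] by blast
  \<comment> \<open>Every tail sum of \<open>m \<odot> y\<close> is infinity, so it lies above
    \<open>u\<close>; since \<open>x j\<close> is way below \<open>u\<close>, a finite part of the
    tail suffices.\<close>
  have ex: "\<exists>l. x j \<le> m \<odot> (\<Sum>i<l. y (n + i))" for n j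
    using way_below_incseqD[OF x(3) incseq_sum_lessThan[of "\<lambda>i. m \<odot> y (n + i)"]] assms[of n]
    by (auto simp: is_infinity_def inf_sum_def nmult_sum)
  define l where "l = (\<lambda>n j. SOME l. x j \<le> m \<odot> (\<Sum>i<l. y (n + i)))"
  have l: "x j \<le> m \<odot> (\<Sum>i<l n j. y (n + i))" for n j
    unfolding l_def by (rule someI_ex[OF ex])
  \<comment> \<open>Block \<open>j\<close> starts at \<open>N j\<close> and has length
    \<open>l (N j) j\<close>, so the next block starts right after it.\<close>
  define N where "N = rec_nat 0 (\<lambda>j n. n + l n j)"
  have N: "N 0 = 0" "\<And>j. N (Suc j) = N j + l (N j) j"
    by (simp_all add: N_def)
  define z where "z = (\<lambda>j. \<Sum>i<l (N j) j. y (N j + i))"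
  have z_sum: "(\<Sum>j<J. z j) = (\<Sum>i<N J. y i)" for J
  proof (induction J)
    case (Suc J)
    have "(\<Sum>i<a + b. y i) = (\<Sum>i<a. y i) + (\<Sum>i<b. y (a + i))" for a b
      by (induction b) (simp_all add: ac_simps)
    with Suc show ?case
      by (simp add: N z_def)
  qed (simp add: N)
  show ?thesis
  proof (rule that)
    show "full_seq x"
      using x u by (simp add: full_seq_def full_if_infinity)
    show "x j \<le> m \<odot> z j" for j
      unfolding z_def by (rule l)
    show "inf_sum z \<le> inf_sum y"
      by (rule inf_sum_least) (simp add: z_sum partial_sum_le_inf_sum)
  qed
qed

theorem proposition9p3:
  defines "cond_i \<equiv> CFP4S TYPE('a::cu)"
    and "cond_ii \<equiv> (\<forall>y :: nat \<Rightarrow> 'a.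
      (\<exists>x. full_seq x \<and> (\<exists>m>0. \<forall>i. x i \<le> m \<odot> y i)) \<longrightarrow> is_infinity (inf_sum y))"
    and "cond_iii \<equiv> (\<forall>y :: nat \<Rightarrow> 'a.
      (\<exists>m>0. \<forall>i. is_infinity (m \<odot> y i)) \<longrightarrow> is_infinity (inf_sum y))"
    and "cond_iv \<equiv> (\<forall>y :: nat \<Rightarrow> 'a.
      (\<exists>m>0. \<forall>n. is_infinity (inf_sum (\<lambda>i. m \<odot> y (n + i)))) \<longrightarrow> is_infinity (inf_sum y))"
    and "cond_v \<equiv> (\<forall>y :: 'a.
      full y \<longrightarrow> (\<exists>m>0. omega_decomposable m y) \<longrightarrow> properly_infinite y)"
  shows "(cond_i \<longleftrightarrow> cond_ii) \<and> (cond_i \<longleftrightarrow> cond_iii) \<and> (cond_i \<longleftrightarrow> cond_iv) \<and> (cond_i \<longleftrightarrow> cond_v)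
    \<and> (\<forall>y :: 'a. full y \<longrightarrow> properly_infinite y \<longrightarrow> is_infinity y)"
proof -
  \<comment> \<open>The implications form the equivalence of (i) and (ii) and two cycles through
    (ii): (ii), (iv), (iii), (ii) and (ii), (v), (iii), (ii).\<close>
  have i_ii: cond_ii if cond_i
    using that CFP4S_imp_infinity unfolding cond_i_def cond_ii_def by blast
  have ii_i: cond_i if cond_ii
    using that CFP4S_if_infinity unfolding cond_i_def cond_ii_def by blast
  have iii_ii: cond_ii if iii: cond_iii
    unfolding cond_ii_def
  proof (intro allI impI, elim exE conjE)
    fix x y :: "nat \<Rightarrow> 'a" and m
    assume "full_seq x" "m > 0" "\<forall>i. x i \<le> m \<odot> y i"
    then have "is_infinity (inf_sum (\<lambda>j. inf_sum (\<lambda>i. y (prod_encode (j, i)))))"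
      using iii[unfolded cond_iii_def, rule_format, of "\<lambda>j. inf_sum (\<lambda>i. y (prod_encode (j, i)))"]
        row_sum_infinity[of x m y] by auto
    then show "is_infinity (inf_sum y)"
      by (rule is_infinity_mono[OF _ inf_sum_rows_le])
  qed
  have ii_iv: cond_iv if ii: cond_ii
    unfolding cond_iv_def
  proof (intro allI impI, elim exE conjE)
    fix y :: "nat \<Rightarrow> 'a" and m
    assume "m > 0" and inf: "\<forall>n. is_infinity (inf_sum (\<lambda>i. m \<odot> y (n + i)))"
    obtain x z where "full_seq x" "\<And>j. x j \<le> m \<odot> z j" "inf_sum z \<le> inf_sum y"
      using full_seq_blocks[of m y] inf by blast
    then show "is_infinity (inf_sum y)"
      using ii \<open>m > 0\<close> is_infinity_mono unfolding cond_ii_def by blast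
  qed
  have iv_iii: cond_iii if iv: cond_iv
    unfolding cond_iii_def
  proof (intro allI impI, elim exE conjE)
    fix y :: "nat \<Rightarrow> 'a" and m
    assume "m > 0" and inf: "\<forall>i. is_infinity (m \<odot> y i)"
    have "m \<odot> y (n + 0) \<le> inf_sum (\<lambda>i. m \<odot> y (n + i))" for n
      using finite_sum_le_inf_sum[of "{0}" "\<lambda>i. m \<odot> y (n + i)"] by simp
    then have "is_infinity (inf_sum (\<lambda>i. m \<odot> y (n + i)))" for n
      using inf is_infinity_mono by blast
    then show "is_infinity (inf_sum y)"
      using iv[unfolded cond_iv_def, rule_format, of y] \<open>m > 0\<close> by auto
  qed
  have ii_v: cond_v if ii: cond_ii
    unfolding cond_v_def omega_decomposable_def
  proof (intro allI impI, elim exE conjE)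
    fix u :: 'a and m x
    assume "full u" "m > 0" "inf_sum x \<le> u" "\<forall>i. u \<le> m \<odot> x i"
    \<comment> \<open>Condition (ii) is used with the constant sequence \<open>u\<close>, which is
      full; it makes \<open>inf_sum x\<close>, and hence \<open>u\<close>, infinity.\<close>
    then have "is_infinity u"
      using ii is_infinity_mono full_seq_const[of u] unfolding cond_ii_def by blast
    then show "properly_infinite u"
      by (rule infinity_imp_properly_infinite)
  qed
  have v_iii: cond_iii if v: cond_v
    unfolding cond_iii_def
  proof (intro allI impI, elim exE conjE)
    fix y :: "nat \<Rightarrow> 'a" and m
    assume "m > 0" and inf: "\<forall>i. is_infinity (m \<odot> y i)"
    have "full (inf_sum y)"
      using inf full_if_nmult_infinity[of m "y 0"] finite_sum_le_inf_sum[of "{0}" y]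
      by (auto elim: full_mono)
    \<comment> \<open>The sequence \<open>y\<close> itself is the witness: each
      \<open>m \<odot> y i\<close> is infinity and so lies above \<open>inf_sum y\<close>.\<close>
    moreover have "omega_decomposable m (inf_sum y)"
      using inf by (auto simp: omega_decomposable_def is_infinity_def)
    ultimately show "is_infinity (inf_sum y)"
      using v \<open>m > 0\<close> properly_infinite_full_imp_infinity unfolding cond_v_def by blast
  qed
  show ?thesis
    using i_ii ii_i iii_ii ii_iv iv_iii ii_v v_iii properly_infinite_full_imp_infinity by blast
qed

end
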